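(* Let $G=(V,E)$ be a finite undirected graph without loops, $V=\{1,\dots,N\}$, let $\alpha\in[0,1]$, and let $(Z_i^t)_{i\in V,\,t\ge 0}$ be the proportions of black balls in the interacting urn process on $G$ with signal parameter $\alpha$. Suppose that $G$ is connected. Then for any $i,j\in V$, almost surely, $\lim_{t\to\infty}Z_i^t=\lim_{t\to\infty}Z_j^t$ (both limits existing almost surely).
   Context: Interacting urn process on $G$ with parameter $\alpha$. Let $N(i)$ be the set of neighbors of $i$ in $G$ and $d_i=|N(i)|$ its degree. Each agent $i\in V$ has an urn containing white and black balls; $B_i^t$ and $W_i^t$ are the numbers of black and white balls in urn $i$ after step $t$, $S_i^t=B_i^t+W_i^t$, and $Z_i^t=B_i^t/S_i^t$ is the proportion of black balls. Initialization ($t=0$): each agent $i$ receives a signal that is correct with probability $\alpha$ and wrong with probability $1-\alpha$; urn $i$ initially contains exactly one ball, white if the signal is correct and black if it is wrong. So $S_i^0=1$. Dynamics: at each step $t+1$ ($t\ge 0$), each agent $i$ draws one ball uniformly at random from urn $i$, with replacement. Let $X_i^{t+1}\in\{0,1\}$ be the indicator that agent $i$'s draw is black. Let $\mathcal{F}_t$ be the sigma-field generated by the initial urn contents and all the draws $X^k=(X_1^k,\dots,X_N^k)$, $1\le k\le t$. Conditionally on $\mathcal{F}_t$, the variables $X_1^{t+1},\dots,X_N^{t+1}$ are pairwise independent and $\mathbb{P}(X_i^{t+1}=1\mid\mathcal{F}_t)=Z_i^t$. Each agent then adds to his urn one ball of the drawn color for each neighbor's draw: $$B_i^{t+1}=B_i^t+\sum_{j\in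 N(i)}X_j^{t+1},\qquad W_i^{t+1}=W_i^t+d_i-\sum_{j\in N(i)}X_j^{t+1},$$ so that $S_i^t=1+d_i t$. *)

theory Defs
  imports "HOL-Probability.Probability" "Graph_Theory.Graph_Theory"
begin

text \<open>
  Undirected graphs are symmetric digraphs; the arcs are pairs of vertices, so there are no
  multiple edges.
\<close>

definition neighbours :: "'v pair_pre_digraph \<Rightarrow> 'v \<Rightarrow> 'v set" where
  "neighbours G i = {j. (i, j) \<in> parcs G}"

definition degree_of :: "'v pair_pre_digraph \<Rightarrow> 'v \<Rightarrow> nat" where
  "degree_of G i = card (neighbours G i)"

text \<open>
  In the following, \<open>C i\<close> is the event that the signal of agent \<open>i\<close> is correct, and
  \<open>X i k\<close> (for \<open>k \<ge> 1\<close>) is the indicator that agent \<open>i\<close> draws a black ball at step \<open>k\<close>;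
  \<open>X i 0\<close> plays no role. Numbers of balls are real-valued, to avoid truncated subtraction.
\<close>

primrec black ::
  "'v pair_pre_digraph \<Rightarrow> ('v \<Rightarrow> 'w set) \<Rightarrow> ('v \<Rightarrow> nat \<Rightarrow> 'w \<Rightarrow> real) \<Rightarrow> 'v \<Rightarrow> nat \<Rightarrow> 'w \<Rightarrow> real"
where
  "black G C X i 0 = (\<lambda>\<omega>. if \<omega> \<in> C i then 0 else 1)"
| "black G C X i (Suc t) =
     (\<lambda>\<omega>. black G C X i t \<omega> + (\<Sum>j\<in>neighbours G i. X j (Suc t) \<omega>))"

primrec white ::
  "'v pair_pre_digraph \<Rightarrow> ('v \<Rightarrow> 'w set) \<Rightarrow> ('v \<Rightarrow> nat \<Rightarrow> 'w \<Rightarrow> real) \<Rightarrow> 'v \<Rightarrow> nat \<Rightarrow> 'w \<Rightarrow> real"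
where
  "white G C X i 0 = (\<lambda>\<omega>. if \<omega> \<in> C i then 1 else 0)"
| "white G C X i (Suc t) =
     (\<lambda>\<omega>. white G C X i t \<omega> + (real (degree_of G i) - (\<Sum>j\<in>neighbours G i. X j (Suc t) \<omega>)))"

definition total ::
  "'v pair_pre_digraph \<Rightarrow> ('v \<Rightarrow> 'w set) \<Rightarrow> ('v \<Rightarrow> nat \<Rightarrow> 'w \<Rightarrow> real) \<Rightarrow> 'v \<Rightarrow> nat \<Rightarrow> 'w \<Rightarrow> real"
where
  "total G C X i t \<omega> = black G C X i t \<omega> + white G C X i t \<omega>"

definition proportion ::
  "'v pair_pre_digraph \<Rightarrow> ('v \<Rightarrow> 'w set) \<Rightarrow> ('v \<Rightarrow> nat \<Rightarrow> 'w \<Rightarrow> real) \<Rightarrow> 'v \<Rightarrow> nat \<Rightarrow> 'w \<Rightarrow> real"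
where
  "proportion G C X i t \<omega> = black G C X i t \<omega> / total G C X i t \<omega>"

lemma total_eq: "total G C X i t \<omega> = 1 + real (degree_of G i) * real t"
  by (induction t) (auto simp: total_def algebra_simps)

definition history ::
  "'w measure \<Rightarrow> 'v pair_pre_digraph \<Rightarrow> ('v \<Rightarrow> 'w set) \<Rightarrow> ('v \<Rightarrow> nat \<Rightarrow> 'w \<Rightarrow> real) \<Rightarrow> nat
    \<Rightarrow> 'w measure"
where
  "history M G C X t = sigma (space M)
     ({black G C X i 0 -` A \<inter> space M | i A. i \<in> pverts G \<and> A \<in> sets borel} \<union>
      {white G C X i 0 -` A \<inter> space M | i A. i \<in> pverts G \<and> A \<in> sets borel} \<union>
      {X i k -` A \<inter> space M | i k A. i \<in> pverts G \<and> k \<in> {1..t} \<and> A \<in> sets borel})"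

definition cond_indep_rv ::
  "'w measure \<Rightarrow> 'w measure \<Rightarrow> ('w \<Rightarrow> real) \<Rightarrow> ('w \<Rightarrow> real) \<Rightarrow> bool"
where
  "cond_indep_rv M F X Y \<longleftrightarrow>
     (\<forall>A\<in>sets borel. \<forall>B\<in>sets borel. AE \<omega> in M.
        real_cond_exp M F (indicator (X -` A \<inter> Y -` B \<inter> space M)) \<omega> =
        real_cond_exp M F (indicator (X -` A \<inter> space M)) \<omega> *
        real_cond_exp M F (indicator (Y -` B \<inter> space M)) \<omega>)"

text \<open>
  Only the marginal laws of the signals are prescribed; their joint law is arbitrary.
\<close>

locale interacting_urn_process = prob_space M
  for M :: "'w measure" +
  fixes G :: "'v pair_pre_digraph"
    and \<alpha> :: real
    and C :: "'v \<Rightarrow> 'w set"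
    and X :: "'v \<Rightarrow> nat \<Rightarrow> 'w \<Rightarrow> real"
  assumes signal_event: "i \<in> pverts G \<Longrightarrow> C i \<in> events"
    and signal_prob: "i \<in> pverts G \<Longrightarrow> prob (C i) = \<alpha>"
    and draw_measurable: "i \<in> pverts G \<Longrightarrow> k \<ge> 1 \<Longrightarrow> random_variable borel (X i k)"
    and draw_indicator:
      "i \<in> pverts G \<Longrightarrow> k \<ge> 1 \<Longrightarrow> \<omega> \<in> space M \<Longrightarrow> X i k \<omega> \<in> {0, 1}"
    and draw_prob:
      "i \<in> pverts G \<Longrightarrow> AE \<omega> in M.
         real_cond_exp M (history M G C X t) (indicator {\<omega> \<in> space M. X i (Suc t) \<omega> = 1}) \<omega>
           = proportion G C X i t \<omega>"
    and draw_cond_indep: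
      "i \<in> pverts G \<Longrightarrow> j \<in> pverts G \<Longrightarrow> i \<noteq> j \<Longrightarrow>
         cond_indep_rv M (history M G C X t) (X i (Suc t)) (X j (Suc t))"
begin

lemma subalgebra_history: "subalgebra M (history M G C X t)"
proof -
  have b: "black G C X i 0 \<in> borel_measurable M" and w: "white G C X i 0 \<in> borel_measurable M"
    if "i \<in> pverts G" for i
    using signal_event[OF that] by (auto intro!: measurable_If_set)
  show ?thesis
    unfolding subalgebra_def history_def
    by (subst sets_measure_of, blast)
      (auto intro!: sets.sigma_sets_subset measurable_sets[OF b] measurable_sets[OF w]
          measurable_sets[OF draw_measurable] simp: space_measure_of_conv
          simp del: black.simps white.simps)
qed

end

end

theory Submission
  imports Defs "HOL-Computational_Algebra.Nth_Powers"
begin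

text \<open>
  If \<open>H\<close> is bounded and adapted, the terms \<open>H t * (X j (Suc t) - Z j t)\<close> are bounded and pairwise
  orthogonal, so their series with weights \<open>1 / (t + 1)\<close> converges almost surely: its sum over the
  block of all \<open>t\<close> between \<open>k\<^sup>3\<close> and \<open>(k + 1)\<^sup>3\<close> has second moment \<open>O(1 / k\<^sup>4)\<close>, and the harmonic
  mass of that block is \<open>O(1 / k)\<close>. The rest is deterministic. Since \<open>d i * Z i\<close> moves by
  \<open>(\<Sum>j\<in>N i. X j (Suc t) - Z i t) / (t + 1)\<close> up to \<open>O(1 / t\<^sup>2)\<close>, the bounded quantity
  \<open>\<Sum>i. d i * (Z i t)\<^sup>2\<close> loses \<open>(Z i t - Z j t)\<^sup>2 / (t + 1)\<close> per arc \<open>(i, j)\<close> at each step, up to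
  convergent series. So these losses are summable, and as \<open>(Z i t - Z j t)\<^sup>2\<close> varies by
  \<open>O(1 / t)\<close> only, it tends to zero. On the other hand, by symmetry of the arcs, the drift of
  \<open>\<Sum>i. d i * Z i t\<close> vanishes up to \<open>O(1 / t\<^sup>2)\<close>, so this sum converges.
\<close>

section \<open>Series and slowly varying sequences of reals\<close>

lemma summable_inverse_Suc_squared: "summable (\<lambda>n. C / (real n + 1)\<^sup>2)"
proof -
  have "summable (\<lambda>n. inverse ((real (Suc n))\<^sup>2))"
    using inverse_power_summable[of 2, where 'a = real] by (subst summable_Suc_iff) simp
  from summable_mult[OF this, of C] show ?thesis
    by (simp add: divide_inverse add.commute)
qed

lemma summable_difference_iff:
  fixes f :: "nat \<Rightarrow> real"
  shows "summable (\<lambda>n. f (Suc n) - f n) \<longleftrightarrow> convergent f"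
  unfolding summable_iff_convergent sum_lessThan_telescope
  using convergent_diff_const_right_iff[of f "f 0"] by simp

text \<open>Up to a summable term, the squares of \<open>a\<close> change by at most
  \<open>2 * C * (a n / (n + 1))\<close>, so they converge, and so does \<open>a\<close>. A positive
  limit would make the given series dominate a multiple of the harmonic series.\<close>

lemma slowly_varying_tendsto_zero:
  fixes a :: "nat \<Rightarrow> real"
  assumes nonneg: "\<And>n. 0 \<le> a n"
    and step: "\<And>n. \<bar>a (Suc n) - a n\<bar> \<le> C / (real n + 1)"
    and sum: "summable (\<lambda>n. a n / (real n + 1))"
  shows "a \<longlonglongrightarrow> 0"
proof -
  have "C \<ge> 0" using step[of 0] by simp
  \<comment> \<open>Difference of two squares, where \<open>a (Suc n) + a n\<close> is at most
    \<open>2 * a n + C / (n + 1)\<close>.\<close>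
  have bound: "norm ((a (Suc n))\<^sup>2 - (a n)\<^sup>2) \<le> 2 * C * (a n / (real n + 1)) + C\<^sup>2 / (real n + 1)\<^sup>2" for n
  proof -
    have "norm ((a (Suc n))\<^sup>2 - (a n)\<^sup>2) = \<bar>a (Suc n) - a n\<bar> * (a (Suc n) + a n)"
      using nonneg[of n] nonneg[of "Suc n"]
      by (simp add: power2_eq_square square_diff_square_factored abs_mult mult.commute)
    also have "\<dots> \<le> C / (real n + 1) * (2 * a n + C / (real n + 1))"
      using step[of n] nonneg[of n] nonneg[of "Suc n"] \<open>C \<ge> 0\<close> by (intro mult_mono) auto
    also have "\<dots> = 2 * C * (a n / (real n + 1)) + C\<^sup>2 / (real n + 1)\<^sup>2"
      by (simp add: power2_eq_square algebra_simps)
    finally show ?thesis .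
  qed
  have "summable (\<lambda>n. 2 * C * (a n / (real n + 1)) + C\<^sup>2 / (real n + 1)\<^sup>2)"
    by (intro summable_add summable_mult sum summable_inverse_Suc_squared)
  then have "summable (\<lambda>n. (a (Suc n))\<^sup>2 - (a n)\<^sup>2)"
    by (rule summable_comparison_test'[where N = 0]) (use bound in auto)
  then have "convergent (\<lambda>n. (a n)\<^sup>2)"
    using summable_difference_iff[of "\<lambda>n. (a n)\<^sup>2"] by simp
  then obtain b where "(\<lambda>n. (a n)\<^sup>2) \<longlonglongrightarrow> b" by (auto simp: convergent_def)
  then have "(\<lambda>n. sqrt ((a n)\<^sup>2)) \<longlonglongrightarrow> sqrt b" by (rule tendsto_real_sqrt)
  then have lim: "a \<longlonglongrightarrow> sqrt b" using nonneg by simp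
  have "sqrt b \<ge> 0" using lim nonneg by (intro LIMSEQ_le_const) auto
  moreover have "\<not> sqrt b > 0"
  proof
    assume pos: "sqrt b > 0"
    then have "\<forall>\<^sub>F n in sequentially. sqrt b / 2 < a n"
      using order_tendstoD(1)[OF lim, of "sqrt b / 2"] by simp
    then have "\<forall>\<^sub>F n in sequentially.
        norm (inverse (real (Suc n))) \<le> 2 / sqrt b * (a n / (real n + 1))"
    proof eventually_elim
      case (elim n)
      then have "1 \<le> 2 / sqrt b * a n"
        using pos by (simp add: pos_le_divide_eq)
      from divide_right_mono[OF this, of "real n + 1"] show ?case
        by (simp add: divide_inverse add.commute mult.assoc)
    qed
    then have "summable (\<lambda>n. inverse (real (Suc n)))"
      by (rule summable_comparison_test_ev) (intro summable_mult sum)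
    then show False
      using not_summable_harmonic[where 'a = real] by (subst (asm) summable_Suc_iff) simp
  qed
  ultimately show ?thesis using lim by simp
qed

section \<open>The urn recursion at a fixed sample point\<close>

text \<open>Here \<open>z i t\<close> is the proportion after step \<open>t\<close>, while
  \<open>x j t\<close> is the draw of step \<open>t + 1\<close>. All randomness is condensed into
  two assumptions: \<open>noise\<close> controls the degree-weighted sum,
  \<open>weighted_noise\<close> the degree-weighted sum of squares.\<close>

lemma urn_recursion_limits:
  fixes V :: "'v set" and N :: "'v \<Rightarrow> 'v set" and z x :: "'v \<Rightarrow> nat \<Rightarrow> real"
  assumes fin: "finite V"
    and sub: "\<And>i. i \<in> V \<Longrightarrow> N i \<subseteq> V"
    and sym: "\<And>i j. i \<in> V \<Longrightarrow> j \<in> V \<Longrightarrow> j \<in> N i \<longleftrightarrow> i \<in> N j"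
    and z01: "\<And>i t. i \<in> V \<Longrightarrow> 0 \<le> z i t \<and> z i t \<le> 1"
    and x01: "\<And>i t. i \<in> V \<Longrightarrow> 0 \<le> x i t \<and> x i t \<le> 1"
    and rec: "\<And>i t. i \<in> V \<Longrightarrow>
      z i (Suc t) - z i t = (\<Sum>j\<in>N i. x j t - z i t) / (1 + real (card (N i)) * (real t + 1))"
    and noise: "\<And>i j. i \<in> V \<Longrightarrow> j \<in> N i \<Longrightarrow> summable (\<lambda>t. (x j t - z j t) / (real t + 1))"
    and weighted_noise: "\<And>i j. i \<in> V \<Longrightarrow> j \<in> N i \<Longrightarrow>
      summable (\<lambda>t. z i t * (x j t - z j t) / (real t + 1))"
  shows degree_weighted_sum_convergent:
      "convergent (\<lambda>t. \<Sum>i\<in>V. real (card (N i)) * z i t)"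
    and adjacent_differences_tendsto_zero:
      "i \<in> V \<Longrightarrow> j \<in> N i \<Longrightarrow> (\<lambda>t. z i t - z j t) \<longlonglongrightarrow> 0"
proof -
  define \<delta> where "\<delta> i t = z i (Suc t) - z i t" for i t
  define d where "d i = real (card (N i))" for i
  have d_nonneg: "d i \<ge> 0" for i by (simp add: d_def)
  have \<delta>_eq: "\<delta> i t = (\<Sum>j\<in>N i. x j t - z i t) / (1 + d i * (real t + 1))" if "i \<in> V" for i t
    using rec[OF that] by (simp add: \<delta>_def d_def)
  have denom_pos: "1 + d i * (real t + 1) > 0" for i t
    using d_nonneg[of i] by (simp add: add_pos_nonneg)
  have sum_bound: "\<bar>\<Sum>j\<in>N i. x j t - z i t\<bar> \<le> d i" if i: "i \<in> V" for i t
  proof -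
    have "\<bar>\<Sum>j\<in>N i. x j t - z i t\<bar> \<le> (\<Sum>j\<in>N i. 1)"
    proof (rule order_trans[OF sum_abs sum_mono])
      fix j assume "j \<in> N i"
      then show "\<bar>x j t - z i t\<bar> \<le> 1"
        using sub[OF i] z01[OF i, of t] x01[of j t] by (auto simp: abs_le_iff)
    qed
    then show ?thesis by (simp add: d_def)
  qed
  \<comment> \<open>The step size \<open>d i / (1 + d i * (t + 1))\<close> is at most
    \<open>1 / (t + 1)\<close> whatever the degree, including degree zero.\<close>
  have \<delta>_bound: "\<bar>\<delta> i t\<bar> \<le> 1 / (real t + 1)" if i: "i \<in> V" for i t
  proof -
    have "\<bar>\<delta> i t\<bar> \<le> d i / (1 + d i * (real t + 1))"
      using denom_pos[of i t] sum_bound[OF i, of t]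
      by (simp add: \<delta>_eq[OF i] divide_right_mono)
    also have "\<dots> \<le> 1 / (real t + 1)"
      using denom_pos[of i t] by (simp add: divide_simps)
    finally show ?thesis .
  qed
  \<comment> \<open>Moving the 1 of the denominator, which is the initial ball, to the other side
    replaces the degree-dependent step size by the common \<open>1 / (t + 1)\<close>. The price is
    an error \<open>\<delta> i t / (t + 1)\<close> of order \<open>1 / t^2\<close>.\<close>
  have d\<delta>: "d i * \<delta> i t = (\<Sum>j\<in>N i. x j t - z i t) / (real t + 1) - \<delta> i t / (real t + 1)"
    if i: "i \<in> V" for i t
  proof -
    have "(1 + d i * (real t + 1)) * \<delta> i t = (\<Sum>j\<in>N i. x j t - z i t)"
      using denom_pos[of i t] by (simp add: \<delta>_eq[OF i])
    then have "d i * \<delta> i t * (real t + 1) = (\<Sum>j\<in>N i. x j t - z i t) - \<delta> i t"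
      by (simp add: algebra_simps)
    then show ?thesis
      unfolding diff_divide_distrib[symmetric] by (subst nonzero_eq_divide_eq) auto
  qed
  \<comment> \<open>Both sides are sums over arcs, and reversing every arc exchanges its
    endpoints.\<close>
  have swap: "(\<Sum>i\<in>V. \<Sum>j\<in>N i. f i) = (\<Sum>i\<in>V. \<Sum>j\<in>N i. f j)" for f :: "'v \<Rightarrow> real"
  proof -
    have N: "N i = {j \<in> V. j \<in> N i}" if "i \<in> V" for i using sub[OF that] by auto
    have "(\<Sum>i\<in>V. \<Sum>j\<in>N i. f i) = (\<Sum>i\<in>V. \<Sum>j | j \<in> V \<and> j \<in> N i. f i)"
      by (intro sum.cong refl) (use N in auto)
    also have "\<dots> = (\<Sum>j\<in>V. \<Sum>i | i \<in> V \<and> j \<in> N i. f i)"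
      by (rule sum.swap_restrict[OF fin fin])
    also have "\<dots> = (\<Sum>j\<in>V. \<Sum>i\<in>N j. f i)"
      by (intro sum.cong refl) (use sub sym in auto)
    finally show ?thesis .
  qed
  have summable_\<delta>: "summable (\<lambda>t. c t * \<delta> i t / (real t + 1))"
    if i: "i \<in> V" and c: "\<And>t. \<bar>c t\<bar> \<le> K" for i c and K :: real
  proof (rule summable_comparison_test'[where N = 0])
    show "summable (\<lambda>t. K / (real t + 1)\<^sup>2)" by (rule summable_inverse_Suc_squared)
    fix t :: nat
    have "\<bar>c t\<bar> * \<bar>\<delta> i t\<bar> \<le> K * (1 / (real t + 1))"
      using c[of t] \<delta>_bound[OF i, of t] by (intro mult_mono) auto
    from divide_right_mono[OF this, of "real t + 1"]
    show "norm (c t * \<delta> i t / (real t + 1)) \<le> K / (real t + 1)\<^sup>2"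
      by (simp add: abs_mult power2_eq_square)
  qed

  \<comment> \<open>The factor 1 matches the shape of \<open>summable_\<delta>\<close>. The terms
    turn out to be the increments of the degree-weighted sum.\<close>
  have "summable (\<lambda>t. (\<Sum>i\<in>V. \<Sum>j\<in>N i. (x j t - z j t) / (real t + 1))
      - (\<Sum>i\<in>V. 1 * \<delta> i t / (real t + 1)))"
    by (intro summable_diff summable_sum noise summable_\<delta>[where K = 1]) auto
  also have "(\<lambda>t. (\<Sum>i\<in>V. \<Sum>j\<in>N i. (x j t - z j t) / (real t + 1))
      - (\<Sum>i\<in>V. 1 * \<delta> i t / (real t + 1)))
    = (\<lambda>t. (\<Sum>i\<in>V. d i * z i (Suc t)) - (\<Sum>i\<in>V. d i * z i t))"
  proof
    fix t
    \<comment> \<open>By \<open>swap\<close>, the arc sums of \<open>z j t\<close> and of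
      \<open>z i t\<close> agree: the drift cancels and only noise is left.\<close>
    have "(\<Sum>i\<in>V. \<Sum>j\<in>N i. (x j t - z j t) / (real t + 1))
      = (\<Sum>i\<in>V. \<Sum>j\<in>N i. (x j t - z i t) / (real t + 1))"
      using swap[of "\<lambda>i. z i t / (real t + 1)"] by (simp add: diff_divide_distrib sum_subtractf)
    then have "(\<Sum>i\<in>V. \<Sum>j\<in>N i. (x j t - z j t) / (real t + 1))
        - (\<Sum>i\<in>V. 1 * \<delta> i t / (real t + 1)) = (\<Sum>i\<in>V. d i * \<delta> i t)"
      by (simp only: d\<delta> sum_subtractf[where A = V] sum_divide_distrib mult_1_left cong: sum.cong)
    then show "(\<Sum>i\<in>V. \<Sum>j\<in>N i. (x j t - z j t) / (real t + 1))
        - (\<Sum>i\<in>V. 1 * \<delta> i t / (real t + 1)) = (\<Sum>i\<in>V. d i * z i (Suc t)) - (\<Sum>i\<in>V. d i * z i t)"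
      by (simp add: \<delta>_def right_diff_distrib sum_subtractf)
  qed
  finally show "convergent (\<lambda>t. \<Sum>i\<in>V. real (card (N i)) * z i t)"
    using summable_difference_iff[of "\<lambda>t. \<Sum>i\<in>V. d i * z i t"] by (simp only: d_def)

  \<comment> \<open>\<open>U\<close> is a Lyapunov function, \<open>D\<close> the Dirichlet energy
    summed over arcs, and \<open>g\<close> collects the noise and the second-order errors in the
    increments of \<open>U\<close>.\<close>
  define U where "U t = (\<Sum>i\<in>V. d i * (z i t)\<^sup>2)" for t
  define D where "D t = (\<Sum>i\<in>V. \<Sum>j\<in>N i. (z i t - z j t)\<^sup>2)" for t
  define g where "g t = (\<Sum>i\<in>V. \<Sum>j\<in>N i. 2 * (z i t * (x j t - z j t) / (real t + 1)))
      + (\<Sum>i\<in>V. (\<Sum>j\<in>N i. x j t - z i t) * \<delta> i t / (real t + 1)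
               - (2 * z i t + \<delta> i t) * \<delta> i t / (real t + 1))" for t
  have "summable g"
    unfolding g_def
  proof (intro summable_add summable_sum summable_diff summable_mult weighted_noise)
    fix i assume i: "i \<in> V"
    show "summable (\<lambda>t. (\<Sum>j\<in>N i. x j t - z i t) * \<delta> i t / (real t + 1))"
      by (rule summable_\<delta>[OF i sum_bound[OF i]])
    show "summable (\<lambda>t. (2 * z i t + \<delta> i t) * \<delta> i t / (real t + 1))"
    proof (rule summable_\<delta>[OF i, where K = 2])
      \<comment> \<open>The sum \<open>2 * z i t + \<delta> i t\<close> is
        \<open>z i t + z i (Suc t)\<close>.\<close>
      fix t show "\<bar>2 * z i t + \<delta> i t\<bar> \<le> 2"
        using z01[OF i, of t] z01[OF i, of "Suc t"] by (simp add: \<delta>_def)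
    qed
  qed
  \<comment> \<open>For each arc, \<open>2 * z i * (x j - z j) - (z i - z j)^2\<close> equals
    \<open>2 * z i * (x j - z i) + (z i)^2 - (z j)^2\<close>, and the last two squares cancel over
    all arcs by \<open>swap\<close>. The result is compared with the increment of \<open>U\<close>,
    in which \<open>d\<delta>\<close> is inserted.\<close>
  have dissipation: "D t / (real t + 1) = g t - (U (Suc t) - U t)" for t
  proof -
    have "(\<Sum>i\<in>V. \<Sum>j\<in>N i. 2 * (z i t * (x j t - z j t) / (real t + 1))) - D t / (real t + 1)
      = (\<Sum>i\<in>V. \<Sum>j\<in>N i. 2 * z i t * (x j t - z i t) / (real t + 1)
          + ((z i t)\<^sup>2 / (real t + 1) - (z j t)\<^sup>2 / (real t + 1)))"
      unfolding D_def sum_divide_distrib sum_subtractf[symmetric]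
      by (intro sum.cong refl) (simp add: algebra_simps add_divide_distrib diff_divide_distrib power2_eq_square)
    also have "\<dots> = (\<Sum>i\<in>V. \<Sum>j\<in>N i. 2 * z i t * (x j t - z i t) / (real t + 1))
        + ((\<Sum>i\<in>V. \<Sum>j\<in>N i. (z i t)\<^sup>2 / (real t + 1)) - (\<Sum>i\<in>V. \<Sum>j\<in>N i. (z j t)\<^sup>2 / (real t + 1)))"
      by (simp only: sum.distrib sum_subtractf)
    also have "\<dots> = (\<Sum>i\<in>V. 2 * z i t * ((\<Sum>j\<in>N i. x j t - z i t) / (real t + 1)))"
      unfolding swap[of "\<lambda>i. (z i t)\<^sup>2 / (real t + 1)"]
      by (simp add: sum_divide_distrib sum_distrib_left)
    finally have 1: "(\<Sum>i\<in>V. \<Sum>j\<in>N i. 2 * (z i t * (x j t - z j t) / (real t + 1)))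
        - D t / (real t + 1) = (\<Sum>i\<in>V. 2 * z i t * ((\<Sum>j\<in>N i. x j t - z i t) / (real t + 1)))" .
    have "U (Suc t) - U t = (\<Sum>i\<in>V. (2 * z i t + \<delta> i t) * (d i * \<delta> i t))"
      unfolding U_def sum_subtractf[symmetric]
      by (intro sum.cong refl) (simp add: \<delta>_def algebra_simps power2_eq_square)
    also have "\<dots> = (\<Sum>i\<in>V. 2 * z i t * ((\<Sum>j\<in>N i. x j t - z i t) / (real t + 1))
        + ((\<Sum>j\<in>N i. x j t - z i t) * \<delta> i t / (real t + 1)
               - (2 * z i t + \<delta> i t) * \<delta> i t / (real t + 1)))"
      by (intro sum.cong refl, subst d\<delta>) (auto simp: algebra_simps add_divide_distrib diff_divide_distrib)
    also have "\<dots> = g t - D t / (real t + 1)"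
      unfolding sum.distrib 1[symmetric] by (simp add: g_def)
    finally show ?thesis by simp
  qed
  have D_nonneg: "D t \<ge> 0" for t by (simp add: D_def sum_nonneg)
  obtain B where B: "\<And>n. (\<Sum>t<n. g t) \<le> B"
  proof -
    have "Bseq (\<lambda>n. \<Sum>t<n. g t)"
      using \<open>summable g\<close> by (simp add: summable_iff_convergent convergent_imp_Bseq)
    then obtain K where "\<And>n. norm (\<Sum>t<n. g t) \<le> K" by (auto simp: Bseq_def)
    then show ?thesis using that[of K] by (metis abs_le_D1 real_norm_def)
  qed
  \<comment> \<open>Summing \<open>dissipation\<close> telescopes \<open>U\<close>; as
    \<open>U n\<close> is nonnegative, the losses add up to at most \<open>B + U 0\<close>.\<close>
  have summable_D: "summable (\<lambda>t. D t / (real t + 1))"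
  proof (rule summableI_nonneg_bounded)
    show "0 \<le> D t / (real t + 1)" for t using D_nonneg by simp
    fix n
    have "U n \<ge> 0" by (simp add: U_def sum_nonneg d_nonneg)
    moreover have "(\<Sum>t<n. D t / (real t + 1)) = (\<Sum>t<n. g t) - (U n - U 0)"
      unfolding dissipation sum_subtractf[of g] sum_lessThan_telescope ..
    ultimately show "(\<Sum>t<n. D t / (real t + 1)) \<le> B + U 0"
      using B[of n] by simp
  qed

  show "(\<lambda>t. z i t - z j t) \<longlonglongrightarrow> 0" if i: "i \<in> V" and j: "j \<in> N i"
  proof -
    have jV: "j \<in> V" using sub i j by auto
    have "(\<lambda>t. (z i t - z j t)\<^sup>2) \<longlonglongrightarrow> 0"
    proof (rule slowly_varying_tendsto_zero)
      \<comment> \<open>Each proportion moves by at most \<open>1 / (t + 1)\<close>, hence their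
        difference by at most \<open>2 / (t + 1)\<close>; two differences add up to at most 2 in
        absolute value. The product gives the constant 4.\<close>
      fix t
      have "\<bar>(z i (Suc t) - z j (Suc t))\<^sup>2 - (z i t - z j t)\<^sup>2\<bar>
        = \<bar>\<delta> i t - \<delta> j t\<bar> * \<bar>(z i (Suc t) - z j (Suc t)) + (z i t - z j t)\<bar>"
        unfolding abs_mult[symmetric] by (simp add: \<delta>_def power2_eq_square algebra_simps)
      also have "\<dots> \<le> 2 / (real t + 1) * 2"
        using \<delta>_bound[OF i, of t] \<delta>_bound[OF jV, of t] z01[OF i, of t] z01[OF i, of "Suc t"]
          z01[OF jV, of t] z01[OF jV, of "Suc t"]
        by (intro mult_mono) (auto simp: abs_le_iff)
      finally show "\<bar>(z i (Suc t) - z j (Suc t))\<^sup>2 - (z i t - z j t)\<^sup>2\<bar> \<le> 4 / (real t + 1)" by simp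
    next
      show "summable (\<lambda>t. (z i t - z j t)\<^sup>2 / (real t + 1))"
      proof (rule summable_comparison_test'[OF summable_D, where N = 0])
        fix t
        have "(z i t - z j t)\<^sup>2 \<le> (\<Sum>j\<in>N i. (z i t - z j t)\<^sup>2)"
          using fin sub[OF i] j by (intro member_le_sum) (auto intro: finite_subset)
        also have "\<dots> \<le> D t"
          unfolding D_def using fin i by (intro member_le_sum) (auto intro: sum_nonneg)
        finally show "norm ((z i t - z j t)\<^sup>2 / (real t + 1)) \<le> D t / (real t + 1)"
          by (simp add: divide_right_mono)
      qed
    qed simp
    from tendsto_real_sqrt[OF this] show ?thesis
      by (simp add: tendsto_rabs_zero_iff)
  qed
qed

section \<open>Series over cubic blocks and orthogonal variables\<close>

text \<open>The block has \<open>3 * k^2 + 3 * k + 1\<close> elements, and its largest weight is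
  \<open>1 / (k^3 + 1)\<close>. Powers of \<open>Suc k\<close> instead of \<open>k\<close> make the
  bounds valid for the block of \<open>k = 0\<close> too.\<close>

lemma cube_block_bounds:
  fixes k :: nat
  shows "real (card {k ^ 3..<Suc k ^ 3}) \<le> 3 * real (Suc k) ^ 2"
    and "m \<in> {k ^ 3..<Suc k ^ 3} \<Longrightarrow> 1 / (real m + 1) \<le> 4 / real (Suc k) ^ 3"
proof -
  have "card {k ^ 3..<Suc k ^ 3} \<le> 3 * Suc k ^ 2"
    by (simp add: power3_eq_cube power2_eq_square algebra_simps)
  then show "real (card {k ^ 3..<Suc k ^ 3}) \<le> 3 * real (Suc k) ^ 2"
    by (metis of_nat_le_iff of_nat_mult of_nat_numeral of_nat_power)
  assume "m \<in> {k ^ 3..<Suc k ^ 3}"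
  then have m: "real k ^ 3 \<le> real m" by (metis atLeastLessThan_iff of_nat_le_iff of_nat_power)
  \<comment> \<open>Equality at \<open>k = 1\<close> shows that 4 is the best constant here.\<close>
  have "4 * (real k ^ 3 + 1) - (real k + 1) ^ 3 = 3 * (real k + 1) * (real k - 1)\<^sup>2"
    by (simp add: power3_eq_cube power2_eq_square algebra_simps)
  also have "\<dots> \<ge> 0" by simp
  finally have "(real k + 1) ^ 3 \<le> 4 * (real k ^ 3 + 1)" by simp
  also have "\<dots> \<le> 4 * (real m + 1)"
    using m by (intro mult_left_mono add_right_mono) simp_all
  finally have "(real k + 1) ^ 3 \<le> 4 * (real m + 1)" .
  then show "1 / (real m + 1) \<le> 4 / real (Suc k) ^ 3"
    by (simp add: divide_simps add.commute mult.commute)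
qed

text \<open>The partial sums converge along the cubes. In between they deviate by at most the
  harmonic mass of one block, which is bounded by \<open>12 / (k + 1)\<close>.\<close>

lemma summable_if_summable_cube_blocks:
  fixes f :: "nat \<Rightarrow> real"
  assumes bound: "\<And>n. \<bar>f n\<bar> \<le> 1 / (real n + 1)"
    and blocks: "summable (\<lambda>k. \<Sum>n\<in>{k ^ 3..<Suc k ^ 3}. f n)"
  shows "summable f"
proof -
  define S where "S n = (\<Sum>m<n. f m)" for n
  have S_diff: "S b - S a = (\<Sum>m\<in>{a..<b}. f m)" if "a \<le> b" for a b
    using that unfolding S_def
    by (metis atLeast0LessThan sum_diff_nat_ivl zero_le)
  have "convergent (\<lambda>k. S (k ^ 3))"
    using blocks summable_difference_iff[of "\<lambda>k. S (k ^ 3)"] by (simp add: S_diff power_mono)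
  then obtain L where L: "(\<lambda>k. S (k ^ 3)) \<longlonglongrightarrow> L" by (auto simp: convergent_def)
  \<comment> \<open>The integer cube root \<open>r n\<close> is the index of the block containing
    \<open>n\<close>.\<close>
  define r where "r = nth_root_nat 3"
  have r: "r n ^ 3 \<le> n" "n < Suc (r n) ^ 3" for n
    unfolding r_def
    by (simp_all add: nth_root_nat_power_le) (metis Suc_n_not_le_n nth_root_nat_nth_power nth_root_nat_mono not_less zero_less_numeral)
  have r_lim: "filterlim r at_top sequentially"
    unfolding filterlim_at_top
  proof
    fix K
    show "\<forall>\<^sub>F n in sequentially. K \<le> r n"
      using eventually_ge_at_top[of "K ^ 3"]
    proof eventually_elim
      case (elim n)
      then show ?case using r(2)[of n] by (metis le_trans less_Suc_eq_le not_less power_less_imp_less_base zero_le)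
    qed
  qed
  have "(\<lambda>n. S n - S (r n ^ 3)) \<longlonglongrightarrow> 0"
  proof (rule tendsto_0_le[where K = 1])
    have "(\<lambda>k. 12 * inverse (real (Suc k))) \<longlonglongrightarrow> 12 * 0"
      by (intro tendsto_intros LIMSEQ_inverse_real_of_nat)
    then show "(\<lambda>n. 12 / real (Suc (r n))) \<longlonglongrightarrow> 0"
      using filterlim_compose[OF _ r_lim] by (simp add: divide_inverse)
    show "\<forall>\<^sub>F n in sequentially. norm (S n - S (r n ^ 3)) \<le> norm (12 / real (Suc (r n))) * 1"
    proof (intro always_eventually allI)
      fix n
      let ?k = "r n"
      have "\<bar>S n - S (?k ^ 3)\<bar> \<le> (\<Sum>m\<in>{?k ^ 3..<n}. \<bar>f m\<bar>)"
        by (simp add: S_diff r)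
      also have "\<dots> \<le> (\<Sum>m\<in>{?k ^ 3..<Suc ?k ^ 3}. \<bar>f m\<bar>)"
        using r(2)[of n] by (intro sum_mono2) auto
      also have "\<dots> \<le> real (card {?k ^ 3..<Suc ?k ^ 3}) * (4 / real (Suc ?k) ^ 3)"
        by (rule sum_bounded_above) (meson bound cube_block_bounds(2) order_trans)
      also have "\<dots> \<le> 3 * real (Suc ?k) ^ 2 * (4 / real (Suc ?k) ^ 3)"
        by (intro mult_right_mono cube_block_bounds) simp
      also have "\<dots> = 12 / real (Suc ?k)"
        by (simp add: field_simps eval_nat_numeral del: of_nat_Suc)
      finally show "norm (S n - S (r n ^ 3)) \<le> norm (12 / real (Suc (r n))) * 1" by simp
    qed
  qed
  from tendsto_add[OF this filterlim_compose[OF L r_lim]] have "S \<longlonglongrightarrow> L" by simp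
  then show ?thesis by (auto simp: summable_iff_convergent convergent_def S_def[abs_def])
qed

text \<open>Orthogonality makes the second moments of the block sums \<open>Y k\<close> so small
  that the \<open>Y k\<close> are almost surely absolutely summable; the deterministic criterion for
  cubic blocks then gives the whole series.\<close>

lemma (in prob_space) AE_summable_if_orthogonal:
  fixes \<xi> :: "nat \<Rightarrow> 'a \<Rightarrow> real"
  assumes [measurable]: "\<And>n. \<xi> n \<in> borel_measurable M"
    and bound: "\<And>n \<omega>. \<omega> \<in> space M \<Longrightarrow> \<bar>\<xi> n \<omega>\<bar> \<le> 1"
    and orth: "\<And>m n. m < n \<Longrightarrow> expectation (\<lambda>\<omega>. \<xi> m \<omega> * \<xi> n \<omega>) = 0"
  shows "AE \<omega> in M. summable (\<lambda>n. \<xi> n \<omega> / (real n + 1))"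
proof -
  define Y where "Y k \<omega> = (\<Sum>n\<in>{k ^ 3..<Suc k ^ 3}. \<xi> n \<omega> / (real n + 1))" for k \<omega>
  have [measurable]: "Y k \<in> borel_measurable M" for k unfolding Y_def by measurable
  have prod_bound: "\<bar>\<xi> m \<omega> * \<xi> n \<omega>\<bar> \<le> 1" if "\<omega> \<in> space M" for m n \<omega>
    using mult_mono[OF bound[OF that, of m] bound[OF that, of n]] by (simp add: abs_mult)
  have int_prod: "integrable M (\<lambda>\<omega>. \<xi> m \<omega> * \<xi> n \<omega>)" for m n
    by (rule integrable_const_bound[where B = 1]) (auto simp: prod_bound)
  have prod_le: "expectation (\<lambda>\<omega>. \<xi> m \<omega> * \<xi> n \<omega>) \<le> (if m = n then 1 else 0)" for m n
  proof (cases m n rule: linorder_cases)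
    case equal
    have "expectation (\<lambda>\<omega>. \<xi> m \<omega> * \<xi> n \<omega>) \<le> expectation (\<lambda>\<omega>. 1)"
      using prod_bound by (intro integral_mono int_prod) (auto simp: abs_le_iff)
    then show ?thesis using equal by (simp add: prob_space)
  qed (use orth[of m n] orth[of n m] in \<open>auto simp: mult.commute\<close>)
  have Y_sq: "(Y k \<omega>)\<^sup>2 = (\<Sum>m\<in>{k ^ 3..<Suc k ^ 3}. \<Sum>n\<in>{k ^ 3..<Suc k ^ 3}.
      \<xi> m \<omega> * \<xi> n \<omega> * (1 / (real m + 1) * (1 / (real n + 1))))" for k \<omega>
    unfolding Y_def power2_eq_square sum_product by (simp add: mult_ac)
  have int_Y: "integrable M (\<lambda>\<omega>. (Y k \<omega>)\<^sup>2)" for k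
    unfolding Y_sq by (intro Bochner_Integration.integrable_sum integrable_mult_left int_prod)
  \<comment> \<open>Only the diagonal survives: at most \<open>3 * (k + 1)^2\<close> terms, each at
    most \<open>16 / (k + 1)^6\<close>.\<close>
  have E_Y: "expectation (\<lambda>\<omega>. (Y k \<omega>)\<^sup>2) \<le> 48 / real (Suc k) ^ 4" for k
  proof -
    let ?I = "{k ^ 3..<Suc k ^ 3}"
    have "expectation (\<lambda>\<omega>. (Y k \<omega>)\<^sup>2) = (\<Sum>m\<in>?I. \<Sum>n\<in>?I.
        expectation (\<lambda>\<omega>. \<xi> m \<omega> * \<xi> n \<omega>) * (1 / (real m + 1) * (1 / (real n + 1))))"
      unfolding Y_sq
      by (simp add: int_prod
          del: times_divide_eq_right times_divide_eq_left)
    also have "\<dots> \<le> (\<Sum>m\<in>?I. \<Sum>n\<in>?I. (if m = n then 1 else 0) * (1 / (real m + 1) * (1 / (real n + 1))))"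
      by (intro sum_mono mult_right_mono prod_le) auto
    also have "\<dots> = (\<Sum>m\<in>?I. 1 / (real m + 1) * (1 / (real m + 1)))"
      by (intro sum.cong refl) (simp add: mult_delta_left
        del: times_divide_eq_left times_divide_eq_right times_divide_times_eq)
    also have "\<dots> \<le> real (card ?I) * (4 / real (Suc k) ^ 3 * (4 / real (Suc k) ^ 3))"
      by (intro sum_bounded_above mult_mono cube_block_bounds) auto
    also have "\<dots> \<le> 3 * real (Suc k) ^ 2 * (4 / real (Suc k) ^ 3 * (4 / real (Suc k) ^ 3))"
      by (intro mult_right_mono cube_block_bounds) simp
    also have "\<dots> = 48 / real (Suc k) ^ 4"
      by (simp add: field_simps eval_nat_numeral del: of_nat_Suc)
    finally show ?thesis .
  qed
  \<comment> \<open>The weight \<open>(k + 1)^2\<close> still leaves the summable expectations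
    \<open>48 / (k + 1)^2\<close>, and it is large enough to pass from squares to absolute values
    below.\<close>
  have "(\<integral>\<^sup>+\<omega>. (\<Sum>k. ennreal (real (Suc k) ^ 2 * (Y k \<omega>)\<^sup>2)) \<partial>M)
      = (\<Sum>k. \<integral>\<^sup>+\<omega>. ennreal (real (Suc k) ^ 2 * (Y k \<omega>)\<^sup>2) \<partial>M)"
    by (rule nn_integral_suminf) measurable
  also have "\<dots> \<le> (\<Sum>k. ennreal (48 / (real k + 1)\<^sup>2))"
  proof (intro suminf_le summableI)
    fix k
    have "(\<integral>\<^sup>+\<omega>. ennreal (real (Suc k) ^ 2 * (Y k \<omega>)\<^sup>2) \<partial>M)
        = ennreal (real (Suc k) ^ 2 * expectation (\<lambda>\<omega>. (Y k \<omega>)\<^sup>2))"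
      using int_Y[of k] by (subst nn_integral_eq_integral) auto
    also have "\<dots> \<le> ennreal (real (Suc k) ^ 2 * (48 / real (Suc k) ^ 4))"
      by (intro ennreal_leI mult_left_mono E_Y) simp
    also have "real (Suc k) ^ 2 * (48 / real (Suc k) ^ 4) = 48 / (real (Suc k))\<^sup>2"
      by (simp add: field_simps eval_nat_numeral del: of_nat_Suc)
    finally show "(\<integral>\<^sup>+\<omega>. ennreal (real (Suc k) ^ 2 * (Y k \<omega>)\<^sup>2) \<partial>M) \<le> ennreal (48 / (real k + 1)\<^sup>2)"
      by (simp add: add.commute)
  qed
  also have "\<dots> < \<infinity>"
    unfolding infinity_ennreal_def less_top[symmetric]
    by (rule ennreal_suminf_neq_top[OF summable_inverse_Suc_squared]) simp
  finally have finite_integral: "(\<integral>\<^sup>+\<omega>. (\<Sum>k. ennreal (real (Suc k) ^ 2 * (Y k \<omega>)\<^sup>2)) \<partial>M) < \<infinity>" .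
  have "AE \<omega> in M. (\<Sum>k. ennreal (real (Suc k) ^ 2 * (Y k \<omega>)\<^sup>2)) \<noteq> \<infinity>"
  proof (rule nn_integral_PInf_AE)
    show "(\<integral>\<^sup>+\<omega>. (\<Sum>k. ennreal (real (Suc k) ^ 2 * (Y k \<omega>)\<^sup>2)) \<partial>M) \<noteq> \<infinity>"
      by (rule less_imp_neq[OF finite_integral])
  qed measurable
  then show ?thesis
  proof (rule AE_mp, intro AE_I2 impI)
    fix \<omega> assume \<omega>: "\<omega> \<in> space M" and fin: "(\<Sum>k. ennreal (real (Suc k) ^ 2 * (Y k \<omega>)\<^sup>2)) \<noteq> \<infinity>"
    have "summable (\<lambda>k. real (Suc k) ^ 2 * (Y k \<omega>)\<^sup>2 + 1 / (real k + 1)\<^sup>2)"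
      using fin unfolding infinity_ennreal_def
      by (intro summable_add summable_inverse_Suc_squared summable_suminf_not_top) simp_all
    then have "summable (\<lambda>k. Y k \<omega>)"
    proof (rule summable_comparison_test'[where N = 0])
      fix k
      \<comment> \<open>The inequality \<open>2 * a * b \<le> a^2 + b^2\<close> with
        \<open>a = (k + 1) * \<bar>Y k \<omega>\<bar>\<close> and \<open>b = 1 / (k + 1)\<close>;
        both squares are summable.\<close>
      have "2 * \<bar>Y k \<omega>\<bar> = 2 * (real (Suc k) * \<bar>Y k \<omega>\<bar>) * (1 / real (Suc k))"
        by simp
      also have "\<dots> \<le> (real (Suc k) * \<bar>Y k \<omega>\<bar>)\<^sup>2 + (1 / real (Suc k))\<^sup>2"
        by (rule sum_squares_bound)
      also have "\<dots> = real (Suc k) ^ 2 * (Y k \<omega>)\<^sup>2 + 1 / (real k + 1)\<^sup>2"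
        by (simp add: power_mult_distrib power_divide add.commute)
      finally show "norm (Y k \<omega>) \<le> real (Suc k) ^ 2 * (Y k \<omega>)\<^sup>2 + 1 / (real k + 1)\<^sup>2" by simp
    qed
    then show "summable (\<lambda>n. \<xi> n \<omega> / (real n + 1))"
      unfolding Y_def
    proof (rule summable_if_summable_cube_blocks[rotated])
      show "\<bar>\<xi> n \<omega> / (real n + 1)\<bar> \<le> 1 / (real n + 1)" for n
        using divide_right_mono[OF bound[OF \<omega>, of n], of "real n + 1"] by (simp add: abs_divide)
    qed
  qed
qed

section \<open>Measurability and innovations of the urn process\<close>

context interacting_urn_process
begin

lemma space_history: "space (history M G C X t) = space M"
  using subalgebra_history[of t] by (simp add: subalgebra_def)

lemma in_sets_historyI:
  assumes "S \<in> {black G C X i 0 -` A \<inter> space M | i A. i \<in> pverts G \<and> A \<in> sets borel} \<union>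
      {white G C X i 0 -` A \<inter> space M | i A. i \<in> pverts G \<and> A \<in> sets borel} \<union>
      {X i k -` A \<inter> space M | i k A. i \<in> pverts G \<and> k \<in> {1..t} \<and> A \<in> sets borel}"
  shows "S \<in> sets (history M G C X t)"
  unfolding history_def by (subst sets_measure_of) (use assms in \<open>auto intro!: sigma_sets.Basic\<close>)

lemma draw_measurable_history:
  assumes "i \<in> pverts G" "1 \<le> k" "k \<le> t"
  shows "X i k \<in> borel_measurable (history M G C X t)"
  by (rule measurableI) (use assms in \<open>auto simp: space_history intro!: in_sets_historyI\<close>)

lemma black_measurable_history:
  assumes "\<And>i. i \<in> pverts G \<Longrightarrow> neighbours G i \<subseteq> pverts G" "i \<in> pverts G" "s \<le> t"
  shows "black G C X i s \<in> borel_measurable (history M G C X t)"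
  using \<open>s \<le> t\<close>
proof (induction s)
  case 0
  show ?case
    by (rule measurableI)
      (use assms(2) in \<open>auto simp: space_history simp del: black.simps white.simps intro!: in_sets_historyI\<close>)
next
  case (Suc s)
  have "X j (Suc s) \<in> borel_measurable (history M G C X t)" if "j \<in> neighbours G i" for j
    using assms that Suc.prems by (intro draw_measurable_history) auto
  then show ?case
    using Suc by (auto intro!: borel_measurable_add borel_measurable_sum)
qed

lemma proportion_measurable_history:
  assumes "\<And>i. i \<in> pverts G \<Longrightarrow> neighbours G i \<subseteq> pverts G" "i \<in> pverts G" "s \<le> t"
  shows "proportion G C X i s \<in> borel_measurable (history M G C X t)"
  using black_measurable_history[OF assms]
  by (simp add: proportion_def[abs_def] total_eq)

lemma proportion_bounds:
  assumes "\<And>i. i \<in> pverts G \<Longrightarrow> neighbours G i \<subseteq> pverts G" "i \<in> pverts G" "\<omega> \<in> space M"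
  shows "0 \<le> proportion G C X i t \<omega> \<and> proportion G C X i t \<omega> \<le> 1"
proof -
  have X: "0 \<le> X j (Suc t) \<omega>" "X j (Suc t) \<omega> \<le> 1" if "j \<in> neighbours G i" for j t
    using draw_indicator[OF subsetD[OF assms(1)[OF assms(2)] that], of "Suc t" \<omega>] assms(3) by auto
  have "0 \<le> black G C X i t \<omega>" by (induction t) (auto intro: add_nonneg_nonneg sum_nonneg X)
  moreover have "0 \<le> white G C X i t \<omega>"
  proof (induction t)
    case (Suc t)
    have "(\<Sum>j\<in>neighbours G i. X j (Suc t) \<omega>) \<le> real (degree_of G i)"
      using sum_bounded_above[of "neighbours G i" "\<lambda>j. X j (Suc t) \<omega>" 1] X
      by (simp add: degree_of_def)
    with Suc show ?case by simp
  qed simp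
  ultimately show ?thesis
    by (auto simp: proportion_def total_def divide_le_eq_1)
qed

text \<open>The new total exceeds the old one by the degree, so subtracting the old proportion once
  per neighbour accounts exactly for the growth of the urn.\<close>

lemma proportion_step:
  "proportion G C X i (Suc t) \<omega> - proportion G C X i t \<omega>
    = (\<Sum>j\<in>neighbours G i. X j (Suc t) \<omega> - proportion G C X i t \<omega>)
      / (1 + real (card (neighbours G i)) * (real t + 1))"
proof -
  let ?d = "real (card (neighbours G i))"
  have pos: "1 + ?d * real t > 0" "1 + ?d * (real t + 1) > 0"
    by (auto intro: add_pos_nonneg)
  have "black G C X i t \<omega> = (1 + ?d * real t) * proportion G C X i t \<omega>"
    using pos by (simp add: proportion_def total_eq degree_of_def)
  moreover have "proportion G C X i (Suc t) \<omega>
      = (black G C X i t \<omega> + (\<Sum>j\<in>neighbours G i. X j (Suc t) \<omega>)) / (1 + ?d * (real t + 1))"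
    by (simp add: proportion_def total_eq degree_of_def add.commute)
  ultimately show ?thesis
    using pos by (simp add: sum_subtractf field_simps)
qed

text \<open>A bounded \<open>H\<close> known at time \<open>t\<close> may be taken inside the
  conditional expectation of the next draw given the history, and that conditional expectation is
  the proportion.\<close>

lemma expectation_innovation_eq_zero:
  assumes "\<And>i. i \<in> pverts G \<Longrightarrow> neighbours G i \<subseteq> pverts G" "j \<in> pverts G"
    and H: "H \<in> borel_measurable (history M G C X t)"
    and bounded: "\<And>\<omega>. \<omega> \<in> space M \<Longrightarrow> \<bar>H \<omega>\<bar> \<le> 1"
  shows "expectation (\<lambda>\<omega>. H \<omega> * (X j (Suc t) \<omega> - proportion G C X j t \<omega>)) = 0"
proof -
  let ?F = "history M G C X t"
  let ?Z = "proportion G C X j t"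
  interpret F: finite_measure_subalgebra M ?F
    by unfold_locales (rule subalgebra_history)
  have [measurable]: "X j (Suc t) \<in> borel_measurable M"
    using assms(2) by (intro draw_measurable) auto
  have [measurable]: "H \<in> borel_measurable M" "?Z \<in> borel_measurable M"
    using measurable_from_subalg[OF subalgebra_history] H
      proportion_measurable_history[OF assms(1,2) order_refl] by auto
  define I where "I = (indicator {\<omega> \<in> space M. X j (Suc t) \<omega> = 1} :: 'w \<Rightarrow> real)"
  have [measurable]: "I \<in> borel_measurable M" unfolding I_def by measurable
  \<comment> \<open>Draws take only the values 0 and 1, so the draw coincides with the indicator
    whose conditional expectation \<open>draw_prob\<close> prescribes.\<close>
  have X_eq: "X j (Suc t) \<omega> = I \<omega>" if "\<omega> \<in> space M" for \<omega>
    using draw_indicator[OF assms(2), of "Suc t" \<omega>] that by (auto simp: I_def)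
  have int_I: "integrable M (\<lambda>\<omega>. H \<omega> * I \<omega>)"
    using bounded by (intro integrable_const_bound[where B = 1]) (auto simp: I_def indicator_def)
  have "integrable M (\<lambda>\<omega>. H \<omega> * ?Z \<omega>)"
  proof (rule integrable_const_bound[where B = 1])
    show "AE \<omega> in M. norm (H \<omega> * ?Z \<omega>) \<le> 1"
    proof (rule AE_I2)
      fix \<omega> assume "\<omega> \<in> space M"
      with bounded[of \<omega>] proportion_bounds[OF assms(1,2), of \<omega> t]
      show "norm (H \<omega> * ?Z \<omega>) \<le> 1"
        using mult_mono[of "\<bar>H \<omega>\<bar>" 1 "\<bar>?Z \<omega>\<bar>" 1] by (simp add: abs_mult)
    qed
  qed simp
  moreover have "expectation (\<lambda>\<omega>. H \<omega> * ?Z \<omega>) = expectation (\<lambda>\<omega>. H \<omega> * real_cond_exp M ?F I \<omega>)"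
  proof (rule integral_cong_AE)
    show "AE \<omega> in M. H \<omega> * ?Z \<omega> = H \<omega> * real_cond_exp M ?F I \<omega>"
      using draw_prob[OF assms(2), of t] unfolding I_def by eventually_elim simp
  qed auto
  moreover have "expectation (\<lambda>\<omega>. H \<omega> * real_cond_exp M ?F I \<omega>) = expectation (\<lambda>\<omega>. H \<omega> * I \<omega>)"
    by (rule F.real_cond_exp_intg(2)[OF int_I H]) simp
  moreover have "expectation (\<lambda>\<omega>. H \<omega> * (X j (Suc t) \<omega> - ?Z \<omega>))
      = expectation (\<lambda>\<omega>. H \<omega> * I \<omega> - H \<omega> * ?Z \<omega>)"
    by (intro Bochner_Integration.integral_cong refl) (simp add: X_eq right_diff_distrib)
  ultimately show ?thesis using int_I by simp
qed

text \<open>In the product of two terms with indices \<open>s < t\<close>, every factor except the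
  innovation at \<open>t\<close> is determined by the history up to \<open>t\<close>. The product
  therefore has mean zero.\<close>

lemma AE_summable_innovations:
  assumes sub: "\<And>i. i \<in> pverts G \<Longrightarrow> neighbours G i \<subseteq> pverts G" and j: "j \<in> pverts G"
    and H: "\<And>t. H t \<in> borel_measurable (history M G C X t)"
    and bounded: "\<And>t \<omega>. \<omega> \<in> space M \<Longrightarrow> \<bar>H t \<omega>\<bar> \<le> 1"
  shows "AE \<omega> in M. summable (\<lambda>t. H t \<omega> * (X j (Suc t) \<omega> - proportion G C X j t \<omega>) / (real t + 1))"
proof (rule AE_summable_if_orthogonal)
  define \<xi> where "\<xi> t \<omega> = H t \<omega> * (X j (Suc t) \<omega> - proportion G C X j t \<omega>)" for t \<omega>
  \<comment> \<open>Among the generators of the history only the draws depend on time, and their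
    index range grows.\<close>
  have history_mono: "H s \<in> borel_measurable (history M G C X t)" if "s \<le> t" for s t
  proof (rule measurable_from_subalg[OF _ H])
    show "subalgebra (history M G C X t) (history M G C X s)"
      unfolding subalgebra_def space_history
    proof
      show "sets (history M G C X s) \<subseteq> sets (history M G C X t)"
        unfolding history_def
      proof (subst (1 2) sets_measure_of; (intro sigma_sets_mono' Un_mono order_refl)?)
        have "k \<in> {1..t}" if "k \<in> {1..s}" for k using that \<open>s \<le> t\<close> by simp
        then show "{X i k -` A \<inter> space M | i k A. i \<in> pverts G \<and> k \<in> {1..s} \<and> A \<in> sets borel}
            \<subseteq> {X i k -` A \<inter> space M | i k A. i \<in> pverts G \<and> k \<in> {1..t} \<and> A \<in> sets borel}" by blast
      qed blast+
    qed simp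
  qed
  \<comment> \<open>The term of index \<open>s\<close> contains the draw of step
    \<open>s + 1\<close>, hence the strict inequality.\<close>
  have \<xi>_history: "\<xi> s \<in> borel_measurable (history M G C X t)" if "s < t" for s t
    unfolding \<xi>_def using that
    by (intro borel_measurable_times borel_measurable_diff history_mono draw_measurable_history
        proportion_measurable_history sub j) auto
  show "(\<lambda>\<omega>. H t \<omega> * (X j (Suc t) \<omega> - proportion G C X j t \<omega>)) \<in> borel_measurable M" for t
    using measurable_from_subalg[OF subalgebra_history \<xi>_history[of t "Suc t"]]
    by (simp add: \<xi>_def[abs_def])
  show bound: "\<bar>H t \<omega> * (X j (Suc t) \<omega> - proportion G C X j t \<omega>)\<bar> \<le> 1" if \<omega>: "\<omega> \<in> space M" for t \<omega>
  proof -
    have "\<bar>X j (Suc t) \<omega> - proportion G C X j t \<omega>\<bar> \<le> 1"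
      using draw_indicator[OF j _ \<omega>, of "Suc t"] proportion_bounds[OF sub j \<omega>, of t]
      by (auto simp: abs_le_iff)
    then show ?thesis
      using mult_mono[OF bounded[OF \<omega>, of t], of _ 1] by (simp add: abs_mult)
  qed
  show "expectation (\<lambda>\<omega>. H s \<omega> * (X j (Suc s) \<omega> - proportion G C X j s \<omega>)
      * (H t \<omega> * (X j (Suc t) \<omega> - proportion G C X j t \<omega>))) = 0" if "s < t" for s t
  proof -
    have "expectation (\<lambda>\<omega>. (\<xi> s \<omega> * H t \<omega>) * (X j (Suc t) \<omega> - proportion G C X j t \<omega>)) = 0"
    proof (rule expectation_innovation_eq_zero[OF sub j])
      show "(\<lambda>\<omega>. \<xi> s \<omega> * H t \<omega>) \<in> borel_measurable (history M G C X t)"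
        using \<xi>_history[OF that] H by (rule borel_measurable_times)
      show "\<bar>\<xi> s \<omega> * H t \<omega>\<bar> \<le> 1" if "\<omega> \<in> space M" for \<omega>
        using mult_mono[OF bound[OF that, of s] bounded[OF that, of t]]
        by (simp add: \<xi>_def abs_mult)
    qed
    then show ?thesis by (simp add: \<xi>_def mult_ac)
  qed
qed

end

section \<open>Consensus on a connected graph\<close>

theorem theorem3:
  fixes M :: "'w measure"
    and N :: nat
    and G :: "nat pair_pre_digraph"
    and \<alpha> :: real
    and C :: "nat \<Rightarrow> 'w set"
    and X :: "nat \<Rightarrow> nat \<Rightarrow> 'w \<Rightarrow> real"
    and i j :: nat
  assumes "pair_graph G"
    and "pverts G = {1..N}"
    and "\<alpha> \<in> {0..1}"
    and "interacting_urn_process M G \<alpha> C X"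
    and "Digraph_Component.connected (with_proj G)"
    and "i \<in> pverts G"
    and "j \<in> pverts G"
  shows "AE \<omega> in M.
           convergent (\<lambda>t. proportion G C X i t \<omega>) \<and>
           convergent (\<lambda>t. proportion G C X j t \<omega>) \<and>
           lim (\<lambda>t. proportion G C X i t \<omega>) = lim (\<lambda>t. proportion G C X j t \<omega>)"
proof -
  interpret G: pair_graph G by fact
  interpret interacting_urn_process M G \<alpha> C X by fact
  let ?V = "pverts G" and ?N = "neighbours G"
  let ?Z = "proportion G C X"
  have fin: "finite ?V" by (rule G.pair_finite_verts)
  have sub: "?N k \<subseteq> ?V" for k
    using G.arc_snd_in_verts by (force simp: neighbours_def)
  have finN: "finite (?N k)" for k using fin sub by (rule finite_subset[rotated])
  have sym: "l \<in> ?N k \<longleftrightarrow> k \<in> ?N l" for k l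
    using G.pair_sym_arcs by (auto simp: neighbours_def symmetric_def dest: symD)
  \<comment> \<open>Since the arcs are symmetric, connectedness yields a directed path between any
    two vertices.\<close>
  have reach: "k \<rightarrow>\<^sup>*\<^bsub>with_proj G\<^esub> l" if "k \<in> ?V" "l \<in> ?V" for k l
    using G.symmetric_connected_imp_strongly_connected[OF G.pair_sym_arcs assms(5)] that
    by (auto elim: strongly_connectedE)

  show ?thesis
  proof (cases "\<exists>k\<in>?V. ?N k \<noteq> {}")
    \<comment> \<open>Without arcs a connected graph has a single vertex, and its urn never changes.
      This case is separate because the total degree, by which the limit is divided below, would be
      zero.\<close>
    case False
    have const: "?Z i t \<omega> = ?Z i 0 \<omega>" for t \<omega>
      using False assms(6) proportion_step[of i _ \<omega>] by (induction t) auto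
    have "j = i"
      using reach[OF assms(6,7)]
    proof (induction rule: G.reachable_induct)
      case (step k l)
      then have "l \<in> ?N k" "k \<in> ?V" by (auto simp: neighbours_def dest: G.arc_fst_in_verts)
      with False show ?case by auto
    qed simp
    moreover have "convergent (\<lambda>t. ?Z i t \<omega>)" for \<omega>
      by (subst const) (rule convergent_const)
    ultimately show ?thesis by simp
  next
    case True
    \<comment> \<open>The total degree normalises the convergent degree-weighted sum: the common
      limit will be \<open>L / d\<close>.\<close>
    define d where "d = (\<Sum>k\<in>?V. real (card (?N k)))"
    have "d > 0"
      unfolding d_def using True fin finN by (auto intro!: sum_pos2 simp: card_gt_0_iff)
    have noise: "AE \<omega> in M. \<forall>k\<in>?V. summable (\<lambda>t. (X k (Suc t) \<omega> - ?Z k t \<omega>) / (real t + 1))"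
    proof (intro AE_finite_allI[OF fin])
      fix k assume k: "k \<in> ?V"
      show "AE \<omega> in M. summable (\<lambda>t. (X k (Suc t) \<omega> - ?Z k t \<omega>) / (real t + 1))"
        using AE_summable_innovations[OF sub k, of "\<lambda>_ _. 1"] by simp
    qed
    have weighted_noise: "AE \<omega> in M. \<forall>k\<in>?V. \<forall>l\<in>?V.
        summable (\<lambda>t. ?Z k t \<omega> * (X l (Suc t) \<omega> - ?Z l t \<omega>) / (real t + 1))"
    proof (intro AE_finite_allI[OF fin])
      fix k l assume k: "k \<in> ?V" and l: "l \<in> ?V"
      show "AE \<omega> in M. summable (\<lambda>t. ?Z k t \<omega> * (X l (Suc t) \<omega> - ?Z l t \<omega>) / (real t + 1))"
        using proportion_bounds[OF sub k]
        by (intro AE_summable_innovations[OF sub l] proportion_measurable_history[OF sub k]) auto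
    qed
    from noise weighted_noise AE_space show ?thesis
    proof eventually_elim
      case (elim \<omega>)
      define z where "z k t = ?Z k t \<omega>" for k t
      define x where "x k t = X k (Suc t) \<omega>" for k t
      have z01: "0 \<le> z k t \<and> z k t \<le> 1" if "k \<in> ?V" for k t
        using proportion_bounds[OF sub that] elim by (auto simp: z_def)
      have x01: "0 \<le> x k t \<and> x k t \<le> 1" if "k \<in> ?V" for k t
        using draw_indicator[OF that, of "Suc t" \<omega>] elim by (auto simp: x_def)
      have rec: "z k (Suc t) - z k t
          = (\<Sum>l\<in>?N k. x l t - z k t) / (1 + real (card (?N k)) * (real t + 1))" for k t
        unfolding z_def x_def by (rule proportion_step)
      have noise: "summable (\<lambda>t. (x l t - z l t) / (real t + 1))"
        and weighted_noise: "summable (\<lambda>t. z k t * (x l t - z l t) / (real t + 1))"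
        if "k \<in> ?V" "l \<in> ?N k" for k l
        using elim that(1) subsetD[OF sub that(2)] by (auto simp: x_def z_def)
      have conv: "convergent (\<lambda>t. \<Sum>k\<in>?V. real (card (?N k)) * z k t)"
        by (rule degree_weighted_sum_convergent[OF fin sub sym z01 x01 rec noise weighted_noise])
      have adjacent: "(\<lambda>t. z k t - z l t) \<longlonglongrightarrow> 0" if "k \<in> ?V" "l \<in> ?N k" for k l
        by (rule adjacent_differences_tendsto_zero[OF fin sub sym z01 x01 rec noise weighted_noise that])
      \<comment> \<open>Differences along the arcs of a path add up to the difference of its
        endpoints.\<close>
      have diff: "(\<lambda>t. z k t - z l t) \<longlonglongrightarrow> 0" if "k \<in> ?V" "l \<in> ?V" for k l
        using reach[OF that]
      proof (induction rule: G.reachable_induct)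
        case (step l m)
        then have "l \<in> ?V" "m \<in> ?N l" by (auto simp: neighbours_def dest: G.arc_fst_in_verts)
        from tendsto_add[OF step.IH adjacent[OF this]] show ?case by simp
      qed simp
      obtain L where L: "(\<lambda>t. \<Sum>k\<in>?V. real (card (?N k)) * z k t) \<longlonglongrightarrow> L"
        using conv by (auto simp: convergent_def)
      have lim: "z k \<longlonglongrightarrow> L / d" if k: "k \<in> ?V" for k
      proof -
        \<comment> \<open>Adding the degree-weighted sum of all \<open>z l t\<close> to this null
          sequence gives \<open>d * z k t\<close>, which therefore tends to
          \<open>L\<close>.\<close>
        have "(\<lambda>t. \<Sum>l\<in>?V. real (card (?N l)) * (z k t - z l t)) \<longlonglongrightarrow> (\<Sum>l\<in>?V. real (card (?N l)) * 0)"
          by (intro tendsto_intros diff k)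
        from tendsto_divide[OF tendsto_add[OF this L] tendsto_const[of d]] \<open>d > 0\<close>
        show ?thesis
          by (simp add: right_diff_distrib sum_subtractf d_def flip: sum_distrib_right)
      qed
      from lim[OF assms(6)] lim[OF assms(7)] limI[OF lim[OF assms(6)]] limI[OF lim[OF assms(7)]]
      show ?case by (auto simp: z_def[abs_def] convergent_def)
    qed
  qed
qed

end
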